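(* There exist an absolute constant $C$ and real numbers $c_n$ with $|c_n|\le C$ for all integers $n>1$ such that the following holds for every fixed integer $n>1$. Let $(A_k)_{k\ge1}$ be any sequence of (finite or countably infinite) alphabets and let $\mu_k$ be a probability distribution on $A_k$, such that $|A_k|\to\infty$ and $H_\infty(\mu_k)\to\infty$ as $k\to\infty$, where $$H_\infty(\mu)=\min_{a\in A}\{-\log\mu(a)\}$$ is the min-entropy of a distribution $\mu$ on $A$. For each $k$ let $L_n(\mu_k)$ be the average number of hidden symbols per covertext letter when the stegosystem $St_n(A_k)$ is applied to an i.i.d. covertext sequence with distribution $\mu_k$ and an independent hidden text sequence of i.i.d. uniform bits. Then $$\lim_{k\to\infty}L_n(\mu_k)=\frac{\log(n!)-c_n}{n}.$$
   Context: All logarithms are to base $2$, and $-\log 0=+\infty$. For an alphabet $A$, a word $u\in A^n$ and $a\in A$ let $\nu_u(a)$ be the number of occurrences of $a$ in $u$, and let $$S_u=\{v\in A^n:\ \forall a\in A\ \ \nu_v(a)=\nu_u(a)\}.$$ For each such (finite) set fix an enumeration $S_u=\{s_0,s_1,\dots,s_{|S_u|-1}\}$ (for example lexicographical) depending only on the set $S_u$. Put $m=\lfloor\log_2|S_u|\rfloor$ and write the binary expansion $|S_u|=\sum_{i=0}^m\alpha_i2^i$ with $\alpha_i\in\{0,1\}$, $\alpha_m=1$. The stegosystem $St_n(A)$ applied to a covertext sequence $x^*=x_1x_2\dots$ over $A$ and a hidden text sequence $y^*=y_1y_2\dots$ of bits: the sequence $x^*$ is split into consecutive blocks of length $n$,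 which are processed in order. For a block $u$, a value $d$ of a random variable $\Delta$ is generated, where $$p(\Delta=i)=\frac{\alpha_i2^i}{|S_u|},\qquad i\in\{0,1,\dots,m\};$$ given the blocks, the values of $\Delta$ for different blocks are generated independently of each other and of $y^*$. Then the next $d$ not yet used symbols of $y^*$ are read (and used up); regarded as a binary representation of length $d$, they give an integer $r\in\{0,\dots,2^d-1\}$ (with $r=0$ if $d=0$). The corresponding output block of length $n$ is $s_\tau\in S_u$, where $$\tau=\sum_{l=d+1}^m\alpha_l2^l+r.$$ The average number of hidden symbols per covertext letter, $L_n$, is the expected number of symbols of $y^*$ used up in the processing of one block, divided by $n$. *)

theory Defs
  imports "HOL-Probability.Probability" "HOL-Library.Stream"
begin

definition words :: "'a set \<Rightarrow> nat \<Rightarrow> 'a list set" where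
  "words A n = {u. set u \<subseteq> A \<and> length u = n}"

definition same_counts :: "'a set \<Rightarrow> 'a list \<Rightarrow> 'a list set" where
  "same_counts A u = {v \<in> words A (length u). \<forall>a\<in>A. count_list v a = count_list u a}"

text \<open>An enumeration receives the whole set \<open>S = same_counts A u\<close>, never \<open>u\<close> itself, so it depends
  on the set only.\<close>

definition is_enumeration :: "'a set \<Rightarrow> nat \<Rightarrow> ('a list set \<Rightarrow> nat \<Rightarrow> 'a list) \<Rightarrow> bool" where
  "is_enumeration A n s \<longleftrightarrow>
     (\<forall>u\<in>words A n. bij_betw (s (same_counts A u)) {..<card (same_counts A u)} (same_counts A u))"

definition top_digit :: "nat \<Rightarrow> nat" where
  "top_digit N = nat \<lfloor>log 2 (real N)\<rfloor>"

definition digit :: "nat \<Rightarrow> nat \<Rightarrow> nat" where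
  "digit N i = of_bool (bit N i)"

definition delta_pmf :: "nat \<Rightarrow> nat pmf" where
  "delta_pmf N =
     embed_pmf (\<lambda>i. if i \<le> top_digit N then real (digit N i * 2 ^ i) / real N else 0)"

text \<open>The weights do form a probability distribution, so \<open>embed_pmf\<close> is not junk here.\<close>

lemma sum_digit:
  assumes "N > 0"
  shows "(\<Sum>i\<le>top_digit N. digit N i * 2 ^ i) = N"
proof -
  have "real N < 2 powr (real_of_int \<lfloor>log 2 (real N)\<rfloor> + 1)"
    using assms by (subst log_less_iff[symmetric]) auto
  also have "real_of_int \<lfloor>log 2 (real N)\<rfloor> + 1 = real (Suc (top_digit N))"
    using assms by (simp add: top_digit_def)
  finally have "real N < real (2 ^ Suc (top_digit N))"
    by (simp only: powr_realpow of_nat_power) (simp add: powr_realpow powr_add)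
  then have "N < 2 ^ Suc (top_digit N)"
    by (simp only: of_nat_less_iff)
  then have "take_bit (Suc (top_digit N)) N = N"
    by (simp only: take_bit_nat_eq_self)
  then show ?thesis
    by (simp add: take_bit_sum[of "Suc (top_digit N)"] push_bit_eq_mult digit_def
        atLeast0LessThan lessThan_Suc_atMost del: take_bit_Suc)
qed

lemma pmf_delta_pmf:
  assumes "N > 0"
  shows "pmf (delta_pmf N) i =
    (if i \<le> top_digit N then real (digit N i * 2 ^ i) / real N else 0)"
  unfolding delta_pmf_def
proof (rule pmf_embed_pmf)
  let ?f = "\<lambda>i. if i \<le> top_digit N then real (digit N i * 2 ^ i) / real N else 0"
  have "(\<integral>\<^sup>+ i. ennreal (?f i) \<partial>count_space UNIV) = (\<Sum>i\<le>top_digit N. ennreal (?f i))"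
    by (rule nn_integral_count_space'[of "{..top_digit N}"]) auto
  also have "\<dots> = ennreal (\<Sum>i\<le>top_digit N. ?f i)"
    by (rule sum_ennreal) simp
  also have "(\<Sum>i\<le>top_digit N. ?f i) = real (\<Sum>i\<le>top_digit N. digit N i * 2 ^ i) / real N"
    by (simp add: sum_divide_distrib)
  also have "\<dots> = 1"
    using assms by (simp only: sum_digit) simp
  finally show "(\<integral>\<^sup>+ i. ennreal (?f i) \<partial>count_space UNIV) = 1" by simp
qed simp

text \<open>\<open>horner_sum\<close> takes the least significant digit first, whereas the first bit read is the most
  significant one.\<close>

definition bits_value :: "bool list \<Rightarrow> nat" where
  "bits_value bs = horner_sum of_bool 2 (rev bs)"

definition code_index :: "nat \<Rightarrow> nat \<Rightarrow> bool list \<Rightarrow> nat" where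
  "code_index N d bs = (\<Sum>l\<in>{d<..top_digit N}. digit N l * 2 ^ l) + bits_value bs"

text \<open>The stegosystem on a list of covertext blocks and the not yet used hidden text. For each block,
  the result records the output block and the number of hidden symbols used up.\<close>

primrec stegosystem ::
  "'a set \<Rightarrow> ('a list set \<Rightarrow> nat \<Rightarrow> 'a list) \<Rightarrow> 'a list list \<Rightarrow> bool stream \<Rightarrow> ('a list \<times> nat) list pmf"
where
  "stegosystem A s [] y = return_pmf []"
| "stegosystem A s (u # us) y =
     (let S = same_counts A u in
      bind_pmf (delta_pmf (card S)) (\<lambda>d.
        map_pmf (\<lambda>out. (s S (code_index (card S) d (stake d y)), d) # out)
          (stegosystem A s us (sdrop d y))))"

definition blocks :: "nat \<Rightarrow> nat \<Rightarrow> 'a list \<Rightarrow> 'a list list" where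
  "blocks n N x = map (\<lambda>i. take n (drop (i * n) x)) [0..<N]"

definition hidden_text :: "bool stream measure" where
  "hidden_text = stream_space (measure_pmf (bernoulli_pmf (1 / 2)))"

text \<open>Expected number of hidden symbols used in block \<open>j\<close> (counted from 0), per letter. Blocks
  \<open>0, \<dots>, j\<close> involve only the first \<open>(j + 1) * n\<close> covertext letters, whose joint law under an i.i.d.
  covertext is \<open>replicate_pmf\<close>; a finite prefix avoids product sigma-algebras over the letter type,
  which need not be countable. The hidden text is infinite, as the amount read is not known in
  advance.\<close>

definition hidden_rate ::
  "'a set \<Rightarrow> ('a list set \<Rightarrow> nat \<Rightarrow> 'a list) \<Rightarrow> nat \<Rightarrow> 'a pmf \<Rightarrow> nat \<Rightarrow> real" where
  "hidden_rate A s n \<mu> j =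
     (\<integral>y. measure_pmf.expectation
            (bind_pmf (replicate_pmf (Suc j * n) \<mu>) (\<lambda>x. stegosystem A s (blocks n (Suc j) x) y))
            (\<lambda>out. real (snd (out ! j))) \<partial>hidden_text) / real n"

definition neg_log2 :: "real \<Rightarrow> ereal" where
  "neg_log2 p = (if p = 0 then \<infinity> else ereal (- log 2 p))"

text \<open>For a distribution supported in \<open>A\<close> the infimum is a minimum: only finitely many letters have
  probability above any given positive bound.\<close>

definition min_entropy :: "'a set \<Rightarrow> 'a pmf \<Rightarrow> ereal" where
  "min_entropy A \<mu> = (INF a\<in>A. neg_log2 (pmf \<mu> a))"

text \<open>Alphabets are countable subsets \<open>A k\<close> of a common letter type, \<open>\<mu> k\<close> is concentrated on \<open>A k\<close>,
  and both the size of \<open>A k\<close> and the min-entropy of \<open>\<mu> k\<close> tend to infinity.\<close>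

definition growing_sources :: "(nat \<Rightarrow> 'a set) \<Rightarrow> (nat \<Rightarrow> 'a pmf) \<Rightarrow> bool" where
  "growing_sources A \<mu> \<longleftrightarrow>
     (\<forall>k. countable (A k) \<and> set_pmf (\<mu> k) \<subseteq> A k) \<and>
     (\<forall>N. \<forall>\<^sub>F k in sequentially. infinite (A k) \<or> N \<le> card (A k)) \<and>
     (\<lambda>k. min_entropy (A k) (\<mu> k)) \<longlonglongrightarrow> \<infinity>"

text \<open>HOL cannot quantify over the letter type below the constants. Requiring the same constants to
  work both for letters in \<open>nat\<close> and for letters in an arbitrary type makes them absolute: the
  former already determines \<open>c n\<close> for \<open>n > 1\<close>.\<close>

end

theory Submission
  imports Defs "HOL-Combinatorics.Multiset_Permutations"
begin

text \<open>Whatever the hidden text and the earlier blocks, the number of symbols used in block \<open>u\<close> has law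
  \<open>\<Delta>\<close> for \<open>N = |S\<^sub>u|\<close>, and its mean \<open>E(N)\<close> satisfies \<open>log N - 3 \<le> E(N) \<le> log N\<close>, since the weights of
  the binary digits of \<open>N\<close> decay geometrically below the leading one. By a union bound a block of
  length \<open>n\<close> has a repeated letter with probability at most \<open>n\<^sup>2 max \<mu>\<close>, which tends to 0 as the
  min-entropy grows; otherwise \<open>|S\<^sub>u| = n!\<close>. Always \<open>|S\<^sub>u| \<le> n!\<close>, so the mean tends to \<open>E(n!)\<close>, and
  \<open>c\<^sub>n = log n! - E(n!)\<close> lies in \<open>[0, 3]\<close>.\<close>

section \<open>The mean of the number of bits\<close>

definition mean_bits :: "nat \<Rightarrow> real" where
  "mean_bits N = measure_pmf.expectation (delta_pmf N) real"

lemma set_delta_pmf: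
  assumes "N > 0"
  shows "set_pmf (delta_pmf N) \<subseteq> {..top_digit N}"
  using assms by (auto simp: set_pmf_eq pmf_delta_pmf split: if_splits)

lemma mean_bits_eq:
  assumes "N > 0"
  shows "mean_bits N = (\<Sum>i\<le>top_digit N. real i * (real (digit N i * 2 ^ i) / real N))"
proof -
  have "mean_bits N = (\<Sum>i\<le>top_digit N. real i * pmf (delta_pmf N) i)"
    unfolding mean_bits_def
    using set_delta_pmf[OF assms] by (intro integral_measure_pmf_real) auto
  then show ?thesis using assms by (simp add: pmf_delta_pmf)
qed

lemma top_digit_mono:
  assumes "0 < M" "M \<le> N"
  shows "top_digit M \<le> top_digit N"
proof -
  have "log 2 (real M) \<le> log 2 (real N)" using assms by simp
  then show ?thesis unfolding top_digit_def by (intro nat_mono floor_mono)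
qed

lemma real_top_digit: "N > 0 \<Longrightarrow> real (top_digit N) = real_of_int \<lfloor>log 2 (real N)\<rfloor>"
  by (simp add: top_digit_def)

text \<open>Evaluates the numerator of the gap between \<open>top_digit N\<close> and the mean in
  the extreme case where every digit is 1; the value stays below twice \<open>2 ^ m\<close>.\<close>

lemma sum_weighted_powers:
  "(\<Sum>i\<le>m. (real m - real i) * 2 ^ i) = 2 ^ Suc m - real m - 2"
proof (induction m)
  case (Suc m)
  \<comment> \<open>Each old coefficient grows by 1, and the new top term has coefficient 0.\<close>
  have "(\<Sum>i\<le>Suc m. (real (Suc m) - real i) * 2 ^ i)
      = (\<Sum>i\<le>m. (real m - real i) * 2 ^ i) + (\<Sum>i\<le>m. 2 ^ i)"
    by (simp add: sum.distrib[symmetric] algebra_simps)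
  also have "(\<Sum>i\<le>m. (2::real) ^ i) = 2 ^ Suc m - 1"
    by (induction m) auto
  finally show ?case using Suc by simp
qed simp

text \<open>The weights add up to \<open>N\<close>, so the constant \<open>top_digit N\<close> can
  be averaged along with \<open>i\<close>. The summands are nonnegative and easily bounded, which
  controls the mean from both sides.\<close>

lemma top_digit_diff_mean_bits:
  assumes "N > 0"
  shows "real (top_digit N) - mean_bits N
    = (\<Sum>i\<le>top_digit N. (real (top_digit N) - real i) * real (digit N i * 2 ^ i)) / real N"
proof -
  have "(\<Sum>i\<le>top_digit N. real (digit N i * 2 ^ i)) = real N"
    by (simp only: of_nat_sum[symmetric] sum_digit[OF assms])
  then have "(\<Sum>i\<le>top_digit N. (real (top_digit N) - real i) * real (digit N i * 2 ^ i))
      = real (top_digit N) * real N - (\<Sum>i\<le>top_digit N. real i * real (digit N i * 2 ^ i))"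
    by (simp only: left_diff_distrib sum_subtractf sum_distrib_left[symmetric])
  moreover have "mean_bits N = (\<Sum>i\<le>top_digit N. real i * real (digit N i * 2 ^ i)) / real N"
    unfolding mean_bits_eq[OF assms] sum_divide_distrib by simp
  ultimately show ?thesis using assms by (simp only: diff_divide_distrib) simp
qed

lemma mean_bits_le_top_digit:
  assumes "N > 0"
  shows "mean_bits N \<le> real (top_digit N)"
proof -
  have "0 \<le> real (top_digit N) - mean_bits N"
    unfolding top_digit_diff_mean_bits[OF assms]
    by (intro divide_nonneg_nonneg sum_nonneg mult_nonneg_nonneg) auto
  then show ?thesis by simp
qed

lemma mean_bits_nonneg: "0 \<le> mean_bits N"
  unfolding mean_bits_def by (rule Bochner_Integration.integral_nonneg) simp

lemma mean_bits_le_log: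
  assumes "N > 0"
  shows "mean_bits N \<le> log 2 (real N)"
  using mean_bits_le_top_digit[OF assms] real_top_digit[OF assms] by linarith

text \<open>Of the 3, one unit pays for rounding the logarithm down and two pay for the digits below
  the leading one.\<close>

lemma log_le_mean_bits:
  assumes "N > 0"
  shows "log 2 (real N) - 3 \<le> mean_bits N"
proof -
  let ?m = "top_digit N"
  have "2 powr real ?m \<le> real N"
    unfolding real_top_digit[OF assms] using assms by (subst le_log_iff[symmetric]) auto
  then have m: "(2::real) ^ ?m \<le> real N" by (simp only: powr_realpow)
  have "(\<Sum>i\<le>?m. (real ?m - real i) * real (digit N i * 2 ^ i))
      \<le> (\<Sum>i\<le>?m. (real ?m - real i) * 2 ^ i)"
    by (intro sum_mono mult_left_mono) (auto simp: digit_def)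
  also have "\<dots> \<le> 2 * real N" unfolding sum_weighted_powers power_Suc using m by linarith
  finally have "real ?m - mean_bits N \<le> 2"
    using assms by (simp add: top_digit_diff_mean_bits pos_divide_le_eq)
  then show ?thesis using real_top_digit[OF assms] by linarith
qed

section \<open>The law of the number of bits used in a block\<close>

text \<open>The draw of \<open>d\<close> never consults the hidden text, and earlier blocks affect
  block \<open>j\<close> only through how far that text has been shifted.\<close>

lemma law_stegosystem:
  assumes "j < length us"
  shows "map_pmf (\<lambda>out. snd (out ! j)) (stegosystem A s us y)
    = delta_pmf (card (same_counts A (us ! j)))"
  using assms
\<comment> \<open>\<open>y\<close> is generalised because the tail runs on \<open>sdrop d y\<close>;
  the law obtained there is the same for every \<open>d\<close>, so the first draw integrates
  out.\<close>
proof (induction us arbitrary: j y)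
  case (Cons u us)
  show ?case
  proof (cases j)
    case 0
    then show ?thesis
      by (simp add: Let_def map_bind_pmf pmf.map_comp o_def map_pmf_const bind_return_pmf')
  next
    case (Suc i)
    with Cons show ?thesis
      by (simp add: Let_def map_bind_pmf pmf.map_comp o_def)
  qed
qed simp

text \<open>Block \<open>j\<close> consists of the last \<open>n\<close> of the i.i.d. letters, so
  splitting off the first \<open>j * n\<close> leaves an independent word of length
  \<open>n\<close>.\<close>

lemma law_block:
  "map_pmf (\<lambda>x. blocks n (Suc j) x ! j) (replicate_pmf (Suc j * n) \<mu>) = replicate_pmf n \<mu>"
proof -
  have "map_pmf (\<lambda>x. blocks n (Suc j) x ! j) (replicate_pmf (Suc j * n) \<mu>)
      = map_pmf (\<lambda>x. take n (drop (j * n) x)) (replicate_pmf (j * n + n) \<mu>)"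
    by (simp add: blocks_def nth_append add.commute del: replicate_pmf.simps)
  also have "\<dots> = replicate_pmf (j * n) \<mu> \<bind> (\<lambda>xs. replicate_pmf n \<mu> \<bind>
      (\<lambda>ys. return_pmf (take n (drop (j * n) (xs @ ys)))))"
    by (simp only: replicate_pmf_distrib map_bind_pmf map_return_pmf)
  \<comment> \<open>Cutting at \<open>j * n\<close> recovers \<open>ys\<close> only because words in
    the support have exactly the right lengths.\<close>
  also have "\<dots> = replicate_pmf (j * n) \<mu> \<bind> (\<lambda>xs. replicate_pmf n \<mu> \<bind> return_pmf)"
    by (intro bind_pmf_cong refl) (simp add: set_replicate_pmf)
  finally show ?thesis by (simp add: bind_return_pmf')
qed

text \<open>The common bound \<open>B\<close> turns the inner expectations into finite sums of
  bounded terms, which may be exchanged with the outer expectation.\<close>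

lemma expectation_bind_bounded:
  fixes f :: "'a \<Rightarrow> nat pmf"
  assumes "\<And>x. x \<in> set_pmf p \<Longrightarrow> set_pmf (f x) \<subseteq> {..B}"
  shows "measure_pmf.expectation (bind_pmf p f) real
    = measure_pmf.expectation p (\<lambda>x. measure_pmf.expectation (f x) real)"
proof -
  have "measure_pmf.expectation (bind_pmf p f) real = (\<Sum>i\<le>B. real i * pmf (bind_pmf p f) i)"
    using assms by (intro integral_measure_pmf_real) (auto simp: set_bind_pmf)
  also have "\<dots> = (\<Sum>i\<le>B. measure_pmf.expectation p (\<lambda>x. real i * pmf (f x) i))"
    by (simp add: pmf_bind)
  also have "\<dots> = measure_pmf.expectation p (\<lambda>x. \<Sum>i\<le>B. real i * pmf (f x) i)"
    by (subst Bochner_Integration.integral_sum)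
      (auto intro!: integrable_mult_right measure_pmf.integrable_const_bound[where B=1] simp: pmf_le_1)
  also have "\<dots> = measure_pmf.expectation p (\<lambda>x. measure_pmf.expectation (f x) real)"
  proof (rule integral_cong_AE)
    show "AE x in measure_pmf p. (\<Sum>i\<le>B. real i * pmf (f x) i) = measure_pmf.expectation (f x) real"
      using assms by (auto simp: AE_measure_pmf_iff intro!: integral_measure_pmf_real[symmetric])
  qed auto
  finally show ?thesis .
qed

section \<open>Permutations of a block\<close>

text \<open>Letters outside \<open>A\<close> occur in neither word, so agreement of counts on
  \<open>A\<close> is equality of multisets.\<close>

lemma same_counts_eq:
  assumes "set u \<subseteq> A"
  shows "same_counts A u = permutations_of_multiset (mset u)"
proof (intro set_eqI iffI)
  fix v assume v: "v \<in> same_counts A u"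
  then have "set v \<subseteq> A" and c: "\<forall>a\<in>A. count_list v a = count_list u a"
    by (auto simp: same_counts_def words_def)
  have "count (mset v) a = count (mset u) a" for a
  proof (cases "a \<in> A")
    case False
    with assms \<open>set v \<subseteq> A\<close> have "a \<notin> set u" "a \<notin> set v" by auto
    then show ?thesis by (metis count_eq_zero_iff set_mset_mset)
  qed (use c in \<open>simp add: count_mset\<close>)
  then show "v \<in> permutations_of_multiset (mset u)"
    by (auto simp: permutations_of_multiset_def intro: multiset_eqI)
next
  fix v assume "v \<in> permutations_of_multiset (mset u)"
  then have v: "mset v = mset u" by (auto simp: permutations_of_multiset_def)
  then have "set v = set u" "length v = length u"
    by (auto dest: mset_eq_setD mset_eq_length)
  moreover have "count_list v a = count_list u a" for a
    using v by (metis count_mset)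
  ultimately show "v \<in> same_counts A u"
    using assms by (auto simp: same_counts_def words_def)
qed

lemma card_same_counts_pos: "set u \<subseteq> A \<Longrightarrow> 0 < card (same_counts A u)"
  by (simp add: same_counts_eq card_gt_0_iff)

text \<open>The cardinality is a multinomial coefficient, a quotient of the factorial of the
  length.\<close>

lemma card_same_counts_le:
  assumes "set u \<subseteq> A"
  shows "card (same_counts A u) \<le> fact (length u)"
  using assms by (simp add: same_counts_eq card_permutations_of_multiset)

lemma card_same_counts_distinct:
  assumes "set u \<subseteq> A" "distinct u"
  shows "card (same_counts A u) = fact (length u)"
proof -
  have "permutations_of_multiset (mset u) = permutations_of_set (set u)"
    using assms(2) by (simp add: permutations_of_set_altdef mset_set_set)
  then show ?thesis using assms by (simp add: same_counts_eq distinct_card)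
qed

section \<open>Repeated letters in a block\<close>

text \<open>Letters are added one at a time: a new letter repeats one of \<open>n\<close> earlier
  letters with probability at most \<open>n * M\<close>.\<close>

lemma prob_not_distinct_le:
  fixes \<mu> :: "'a pmf"
  assumes M: "\<And>a. pmf \<mu> a \<le> M"
  shows "measure_pmf.prob (replicate_pmf n \<mu>) {u. \<not> distinct u} \<le> (real n)\<^sup>2 * M"
proof -
  have M0: "0 \<le> M" using M[of undefined] pmf_nonneg[of \<mu> undefined] by linarith
  have mem: "measure_pmf.prob \<mu> (set xs) \<le> real (length xs) * M" for xs
  proof -
    have "measure_pmf.prob \<mu> (set xs) \<le> real (card (set xs)) * M"
      using sum_bounded_above[of "set xs" "pmf \<mu>" M] M by (simp add: measure_measure_pmf_finite)
    also have "\<dots> \<le> real (length xs) * M"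
      using M0 by (intro mult_right_mono) (auto simp: card_length)
    finally show ?thesis .
  qed
  show ?thesis
  proof (induction n)
    case (Suc n)
    \<comment> \<open>The recursion draws the head first; the tail must come first here, so that the
      head is compared with a fixed word.\<close>
    have swap: "replicate_pmf (Suc n) \<mu> = replicate_pmf n \<mu> \<bind> (\<lambda>xs. map_pmf (\<lambda>x. x # xs) \<mu>)"
      unfolding replicate_pmf.simps map_pmf_def by (rule bind_commute_pmf)
    have "emeasure (replicate_pmf (Suc n) \<mu>) {u. \<not> distinct u}
        = (\<integral>\<^sup>+xs. emeasure \<mu> {x. \<not> distinct (x # xs)} \<partial>replicate_pmf n \<mu>)"
      unfolding swap by (simp add: vimage_def)
    \<comment> \<open>If \<open>xs\<close> already has a repetition, the indicator covers the whole
      probability; otherwise the event is \<open>x \<in> set xs\<close>.\<close>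
    also have "\<dots> \<le> (\<integral>\<^sup>+xs. ennreal (real n * M) + indicator {u. \<not> distinct u} xs \<partial>replicate_pmf n \<mu>)"
    proof (intro nn_integral_mono_AE, unfold AE_measure_pmf_iff, intro ballI)
      fix xs assume "xs \<in> set_pmf (replicate_pmf n \<mu>)"
      then have "length xs = n" by (simp add: set_replicate_pmf)
      with mem[of xs] show "emeasure \<mu> {x. \<not> distinct (x # xs)}
          \<le> ennreal (real n * M) + indicator {u. \<not> distinct u} xs"
        using measure_pmf.emeasure_le_1[of \<mu> UNIV]
        by (cases "distinct xs")
          (auto simp: measure_pmf.emeasure_eq_measure ennreal_leI intro: add_increasing)
    qed
    also have "\<dots> = ennreal (real n * M) + emeasure (replicate_pmf n \<mu>) {u. \<not> distinct u}"
      by (subst nn_integral_add) auto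
    finally have "measure_pmf.prob (replicate_pmf (Suc n) \<mu>) {u. \<not> distinct u}
        \<le> real n * M + measure_pmf.prob (replicate_pmf n \<mu>) {u. \<not> distinct u}"
      using M0 by (simp add: measure_pmf.emeasure_eq_measure flip: ennreal_plus del: replicate_pmf.simps)
    also have "\<dots> \<le> real n * M + (real n)\<^sup>2 * M" using Suc by simp
    also have "\<dots> \<le> (real (Suc n))\<^sup>2 * M"
      unfolding distrib_right[symmetric] using M0
      by (intro mult_right_mono) (auto simp: power2_eq_square algebra_simps)
    finally show ?case .
  qed simp
qed

text \<open>Min-entropy above \<open>- log 2 \<epsilon>\<close> bounds all letter probabilities at
  once; letters outside \<open>A k\<close> have probability 0.\<close>

lemma growing_sources_pmf_le:
  assumes "growing_sources A \<mu>" "0 < \<epsilon>"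
  shows "\<forall>\<^sub>F k in sequentially. \<forall>a. pmf (\<mu> k) a \<le> \<epsilon>"
proof -
  have "(\<lambda>k. min_entropy (A k) (\<mu> k)) \<longlonglongrightarrow> \<infinity>" and supp: "\<And>k. set_pmf (\<mu> k) \<subseteq> A k"
    using assms(1) by (auto simp: growing_sources_def)
  then have "\<forall>\<^sub>F k in sequentially. ereal (- log 2 \<epsilon>) < min_entropy (A k) (\<mu> k)"
    by (simp add: tendsto_PInfty)
  then show ?thesis
  proof (rule eventually_mono, intro allI)
    fix k a assume k: "ereal (- log 2 \<epsilon>) < min_entropy (A k) (\<mu> k)"
    show "pmf (\<mu> k) a \<le> \<epsilon>"
    proof (cases "pmf (\<mu> k) a = 0")
      case False
      then have "a \<in> A k" using supp[of k] by (auto simp: set_pmf_eq)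
      then have "min_entropy (A k) (\<mu> k) \<le> neg_log2 (pmf (\<mu> k) a)"
        unfolding min_entropy_def by (rule INF_lower)
      with k have "ereal (- log 2 \<epsilon>) < neg_log2 (pmf (\<mu> k) a)" by (rule less_le_trans)
      with False assms(2) show ?thesis
        by (simp add: neg_log2_def pmf_pos)
    qed (use assms(2) in simp)
  qed
qed

section \<open>The limit of the rate\<close>

text \<open>The inner expectation is the same for every \<open>y\<close>, so averaging over the
  hidden text, a probability space, changes nothing.\<close>

lemma hidden_rate_eq:
  assumes supp: "set_pmf \<mu> \<subseteq> A"
  shows "hidden_rate A s n \<mu> j
    = measure_pmf.expectation (replicate_pmf n \<mu>) (\<lambda>u. mean_bits (card (same_counts A u))) / real n"
proof -
  let ?D = "\<lambda>u. delta_pmf (card (same_counts A u))"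
  have law: "map_pmf (\<lambda>out. snd (out ! j))
      (bind_pmf (replicate_pmf (Suc j * n) \<mu>) (\<lambda>x. stegosystem A s (blocks n (Suc j) x) y))
      = bind_pmf (replicate_pmf n \<mu>) ?D" for y
  proof -
    have "map_pmf (\<lambda>out. snd (out ! j))
        (bind_pmf (replicate_pmf (Suc j * n) \<mu>) (\<lambda>x. stegosystem A s (blocks n (Suc j) x) y))
        = bind_pmf (replicate_pmf (Suc j * n) \<mu>) (\<lambda>x. ?D (blocks n (Suc j) x ! j))"
      unfolding map_bind_pmf
      by (intro bind_pmf_cong refl law_stegosystem) (simp add: blocks_def)
    also have "\<dots> = bind_pmf (map_pmf (\<lambda>x. blocks n (Suc j) x ! j) (replicate_pmf (Suc j * n) \<mu>)) ?D"
      by (simp only: bind_map_pmf)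
    finally show ?thesis by (simp only: law_block)
  qed
  have "measure_pmf.expectation
      (bind_pmf (replicate_pmf (Suc j * n) \<mu>) (\<lambda>x. stegosystem A s (blocks n (Suc j) x) y))
      (\<lambda>out. real (snd (out ! j))) = measure_pmf.expectation (bind_pmf (replicate_pmf n \<mu>) ?D) real" for y
    unfolding law[of y, symmetric] by (simp only: integral_map_pmf)
  moreover have "measure_pmf.expectation (bind_pmf (replicate_pmf n \<mu>) ?D) real
      = measure_pmf.expectation (replicate_pmf n \<mu>) (\<lambda>u. mean_bits (card (same_counts A u)))"
    unfolding mean_bits_def
  proof (rule expectation_bind_bounded)
    fix u assume "u \<in> set_pmf (replicate_pmf n \<mu>)"
    with supp have u: "set u \<subseteq> A" "length u = n" by (auto simp: set_replicate_pmf)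
    then have "card (same_counts A u) \<le> fact n" "0 < card (same_counts A u)"
      using card_same_counts_le[of u A] card_same_counts_pos[of u A] by auto
    \<comment> \<open>The top digit of \<open>fact n\<close> serves as the bound common to all words
      of length \<open>n\<close>.\<close>
    then show "set_pmf (?D u) \<subseteq> {..top_digit (fact n)}"
      using set_delta_pmf[of "card (same_counts A u)"] top_digit_mono[of "card (same_counts A u)" "fact n"]
      by (meson atMost_subset_iff order_trans)
  qed
  moreover have "prob_space hidden_text"
    unfolding hidden_text_def by (rule prob_space.prob_space_stream_space) (rule prob_space_measure_pmf)
  ultimately show ?thesis
    unfolding hidden_rate_def by (simp add: prob_space.prob_space del: replicate_pmf.simps)
qed

text \<open>The integrand equals \<open>mean_bits (fact n)\<close> on words without repetition;
  elsewhere both values lie between 0 and \<open>log 2 (fact n)\<close>.\<close>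

lemma mean_bits_deviation:
  assumes supp: "set_pmf \<mu> \<subseteq> A" and M: "\<And>a. pmf \<mu> a \<le> M"
  shows "\<bar>measure_pmf.expectation (replicate_pmf n \<mu>) (\<lambda>u. mean_bits (card (same_counts A u)))
    - mean_bits (fact n)\<bar> \<le> log 2 (fact n) * ((real n)\<^sup>2 * M)"
proof -
  let ?P = "replicate_pmf n \<mu>" and ?E = "\<lambda>u. mean_bits (card (same_counts A u))"
  let ?B = "log 2 (fact n)" and ?R = "{u. \<not> distinct u}"
  have B0: "0 \<le> ?B" by (simp add: fact_ge_1)
  have bound: "?E u \<in> {0..?B}" and dev: "\<bar>?E u - mean_bits (fact n)\<bar> \<le> ?B * indicator ?R u"
    if "u \<in> set_pmf ?P" for u
  proof -
    from that supp have u: "set u \<subseteq> A" "length u = n" by (auto simp: set_replicate_pmf)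
    let ?N = "card (same_counts A u)"
    have N: "0 < ?N" "?N \<le> fact n"
      using u card_same_counts_le[of u A] card_same_counts_pos[of u A] by auto
    then have "real ?N \<le> fact n" by (metis of_nat_fact of_nat_le_iff)
    with N(1) have "log 2 (real ?N) \<le> ?B" by simp
    then show b: "?E u \<in> {0..?B}"
      using mean_bits_le_log[OF N(1)] mean_bits_nonneg[of ?N] by simp
    have "mean_bits (fact n) \<in> {0..?B}"
      using mean_bits_le_log[of "fact n"] mean_bits_nonneg[of "fact n"] by simp
    with b show "\<bar>?E u - mean_bits (fact n)\<bar> \<le> ?B * indicator ?R u"
      using u card_same_counts_distinct[of u A] by (cases "distinct u") auto
  qed
  have int: "integrable ?P ?E"
    using bound by (intro measure_pmf.integrable_const_bound[where B="?B"]) (auto simp: AE_measure_pmf_iff)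
  then have "\<bar>measure_pmf.expectation ?P ?E - mean_bits (fact n)\<bar>
      = \<bar>measure_pmf.expectation ?P (\<lambda>u. ?E u - mean_bits (fact n))\<bar>"
    by simp
  also have "\<dots> \<le> measure_pmf.expectation ?P (\<lambda>u. \<bar>?E u - mean_bits (fact n)\<bar>)"
    by (rule integral_abs_bound)
  also have "\<dots> \<le> measure_pmf.expectation ?P (\<lambda>u. ?B * indicator ?R u)"
  proof (rule integral_mono_AE)
    show "integrable ?P (\<lambda>u. \<bar>?E u - mean_bits (fact n)\<bar>)" using int by simp
    show "integrable ?P (\<lambda>u. ?B * indicator ?R u)"
      by (intro integrable_mult_right measure_pmf.integrable_const_bound[where B=1]) auto
  qed (use dev in \<open>simp add: AE_measure_pmf_iff\<close>)
  also have "\<dots> = ?B * measure_pmf.prob ?P ?R" by simp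
  also have "\<dots> \<le> ?B * ((real n)\<^sup>2 * M)"
    by (intro mult_left_mono prob_not_distinct_le M B0)
  finally show ?thesis .
qed

lemma hidden_rate_tendsto:
  assumes g: "growing_sources A \<mu>"
  shows "(\<lambda>k. hidden_rate (A k) (s k) n (\<mu> k) j) \<longlonglongrightarrow> mean_bits (fact n) / real n"
proof -
  have supp: "\<And>k. set_pmf (\<mu> k) \<subseteq> A k" using g by (auto simp: growing_sources_def)
  let ?K = "log 2 (fact n) * (real n)\<^sup>2"
  have "(\<lambda>k. measure_pmf.expectation (replicate_pmf n (\<mu> k))
      (\<lambda>u. mean_bits (card (same_counts (A k) u)))) \<longlonglongrightarrow> mean_bits (fact n)"
  proof (rule tendstoI)
    fix e :: real assume "0 < e"
    \<comment> \<open>Adding 1 keeps the denominator positive when \<open>?K\<close> is 0 and makes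
      \<open>?K * M < e\<close> strict.\<close>
    define M where "M = e / (?K + 1)"
    have K: "0 \<le> ?K" by (simp add: fact_ge_1)
    then have M: "0 < M" using \<open>0 < e\<close> by (simp add: M_def add_nonneg_pos)
    have "?K * M < (?K + 1) * M" using M by simp
    also have "\<dots> = e" unfolding M_def using K add_nonneg_pos[of ?K 1] by simp
    finally have Ke: "?K * M < e" .
    show "\<forall>\<^sub>F k in sequentially. dist (measure_pmf.expectation (replicate_pmf n (\<mu> k))
        (\<lambda>u. mean_bits (card (same_counts (A k) u)))) (mean_bits (fact n)) < e"
      using growing_sources_pmf_le[OF g M]
    proof (rule eventually_mono)
      fix k assume "\<forall>a. pmf (\<mu> k) a \<le> M"
      then show "dist (measure_pmf.expectation (replicate_pmf n (\<mu> k))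
          (\<lambda>u. mean_bits (card (same_counts (A k) u)))) (mean_bits (fact n)) < e"
        using mean_bits_deviation[OF supp, of k M n] Ke by (simp add: dist_real_def mult.assoc)
    qed
  qed
  then show ?thesis
    unfolding hidden_rate_eq[OF supp] divide_inverse by (rule tendsto_mult_right)
qed

theorem corollary2:
  shows "\<exists>(C :: real) (c :: nat \<Rightarrow> real).
    (\<forall>n>1. \<bar>c n\<bar> \<le> C) \<and>
    (\<forall>n>1. \<forall>(A :: nat \<Rightarrow> nat set) (\<mu> :: nat \<Rightarrow> nat pmf) s j.
       growing_sources A \<mu> \<longrightarrow> (\<forall>k. is_enumeration (A k) n (s k)) \<longrightarrow>
       (\<lambda>k. hidden_rate (A k) (s k) n (\<mu> k) j) \<longlonglongrightarrow> (log 2 (fact n) - c n) / real n) \<and>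
    (\<forall>n>1. \<forall>(A :: nat \<Rightarrow> 'a set) (\<mu> :: nat \<Rightarrow> 'a pmf) s j.
       growing_sources A \<mu> \<longrightarrow> (\<forall>k. is_enumeration (A k) n (s k)) \<longrightarrow>
       (\<lambda>k. hidden_rate (A k) (s k) n (\<mu> k) j) \<longlonglongrightarrow> (log 2 (fact n) - c n) / real n)"
\<comment> \<open>The witness depends on \<open>n\<close> alone, so one polymorphic limit lemma
  settles both letter types.\<close>
proof (rule exI[of _ 3], rule exI[of _ "\<lambda>n. log 2 (fact n) - mean_bits (fact n)"], intro conjI allI impI)
  fix n :: nat
  show "\<bar>log 2 (fact n) - mean_bits (fact n)\<bar> \<le> 3"
    using mean_bits_le_log[of "fact n"] log_le_mean_bits[of "fact n"] by simp
qed (simp_all add: hidden_rate_tendsto)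

end
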